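(* Let $X$ be a connected digital image and let $A \subseteq X$ be a retract of $X$. Then $$CS(A) \subseteq CS(X).$$
   Context: A digital image is a pair $(X,\kappa)$ with $X \subset \mathbb{Z}^n$ for some $n \in \mathbb{N}$ and $\kappa = \kappa(t,n)$ for some $1 \le t \le n$, where distinct points $p,q \in \mathbb{Z}^n$ are $\kappa(t,n)$-adjacent if at most $t$ of their coordinates differ by $\pm 1$ and all other coordinates coincide. One usually writes $X$ for $(X,\kappa)$. A subset $A \subseteq X$ is regarded as a digital image $(A,\kappa)$ with the same adjacency. Two disjoint subsets of $X$ are adjacent to each other if some point of one is adjacent to some point of the other. A set is connected if it is not a union of two disjoint non-empty sets that are not adjacent to each other. A function $f:(X,\kappa_1)\to(Y,\kappa_2)$ between digital images is continuous if it maps $\kappa_1$-connected subsets of $X$ to $\kappa_2$-connected subsets of $Y$; equivalently, whenever $x,y\in X$ are $\kappa_1$-adjacent, $f(x)$ and $f(y)$ are equal or $\kappa_2$-adjacent. A subset $A$ of $X$ is a retract of $X$ if there is a continuous function $r : X \to A$ (a retraction) with $r(a) = a$ for all $a\in A$. For continuous $f_1,f_2 : X \to X$ let $C(f_1,f_2) = \{x\in X\mid f_1(x) = f_2(x)\}$, and let $\#$ denote cardinality. The coincidence point spectrum of $X$ is $$CS(X) = \{\#C(f_1,f_2) \mid f_1,f_2 : X\to X \text{ are continuous}\},$$ and similarly for $A$, with continuous self-maps of $A$. *)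

theory Defs
  imports "HOL-Analysis.Finite_Cartesian_Product" "HOL-Library.Extended_Nat"
begin

definition kappa :: "nat \<Rightarrow> int ^ 'n \<Rightarrow> int ^ 'n \<Rightarrow> bool" where
  "kappa t p q \<longleftrightarrow>
     p \<noteq> q \<and> card {i. \<bar>p $ i - q $ i\<bar> = 1} \<le> t \<and> (\<forall>i. \<bar>p $ i - q $ i\<bar> = 1 \<or> p $ i = q $ i)"

definition adjacent_sets :: "('a \<Rightarrow> 'a \<Rightarrow> bool) \<Rightarrow> 'a set \<Rightarrow> 'a set \<Rightarrow> bool" where
  "adjacent_sets \<kappa> U V \<longleftrightarrow> (\<exists>u\<in>U. \<exists>v\<in>V. \<kappa> u v)"

definition digitally_connected :: "('a \<Rightarrow> 'a \<Rightarrow> bool) \<Rightarrow> 'a set \<Rightarrow> bool" where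
  "digitally_connected \<kappa> S \<longleftrightarrow>
     \<not> (\<exists>U V. S = U \<union> V \<and> U \<inter> V = {} \<and> U \<noteq> {} \<and> V \<noteq> {} \<and> \<not> adjacent_sets \<kappa> U V)"

text \<open>Maps between images are total functions on the ambient types; only their values on the
  domain image matter.\<close>

definition digitally_continuous ::
  "('a \<Rightarrow> 'a \<Rightarrow> bool) \<Rightarrow> ('b \<Rightarrow> 'b \<Rightarrow> bool) \<Rightarrow> 'a set \<Rightarrow> 'b set \<Rightarrow> ('a \<Rightarrow> 'b) \<Rightarrow> bool" where
  "digitally_continuous \<kappa>1 \<kappa>2 X Y f \<longleftrightarrow>
     f ` X \<subseteq> Y \<and> (\<forall>S\<subseteq>X. digitally_connected \<kappa>1 S \<longrightarrow> digitally_connected \<kappa>2 (f ` S))"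

definition digital_retract :: "('a \<Rightarrow> 'a \<Rightarrow> bool) \<Rightarrow> 'a set \<Rightarrow> 'a set \<Rightarrow> bool" where
  "digital_retract \<kappa> A X \<longleftrightarrow>
     A \<subseteq> X \<and> (\<exists>r. digitally_continuous \<kappa> \<kappa> X A r \<and> (\<forall>a\<in>A. r a = a))"

definition coincidence_set :: "'a set \<Rightarrow> ('a \<Rightarrow> 'b) \<Rightarrow> ('a \<Rightarrow> 'b) \<Rightarrow> 'a set" where
  "coincidence_set X f1 f2 = {x \<in> X. f1 x = f2 x}"

text \<open>Images may be infinite. Subsets of \<open>\<int>\<^sup>n\<close> are countable, so \<open>\<infinity>\<close> is the only
  infinite cardinality that occurs; plain \<^const>\<open>card\<close> would confuse it with 0.\<close>

definition cardinality :: "'a set \<Rightarrow> enat" where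
  "cardinality S = (if finite S then enat (card S) else \<infinity>)"

definition coincidence_spectrum :: "('a \<Rightarrow> 'a \<Rightarrow> bool) \<Rightarrow> 'a set \<Rightarrow> enat set" where
  "coincidence_spectrum \<kappa> X =
     {cardinality (coincidence_set X f1 f2) | f1 f2.
        digitally_continuous \<kappa> \<kappa> X X f1 \<and> digitally_continuous \<kappa> \<kappa> X X f2}"

lemma kappa_sym: "kappa t p q \<Longrightarrow> kappa t q p"
proof -
  have "\<bar>q $ i - p $ i\<bar> = \<bar>p $ i - q $ i\<bar>" for i
    by (rule abs_minus_commute)
  then show "kappa t p q \<Longrightarrow> kappa t q p"
    unfolding kappa_def by auto
qed

lemma digitally_connected_iff:
  "digitally_connected \<kappa> S \<longleftrightarrow>
     (\<forall>U V. S = U \<union> V \<longrightarrow> U \<inter> V = {} \<longrightarrow> U \<noteq> {} \<longrightarrow> V \<noteq> {} \<longrightarrow> (\<exists>u\<in>U. \<exists>v\<in>V. \<kappa> u v))"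
  unfolding digitally_connected_def adjacent_sets_def by blast

lemma digitally_connected_pair:
  assumes "\<kappa> x y" "\<kappa> y x"
  shows "digitally_connected \<kappa> {x, y}"
  unfolding digitally_connected_iff
proof (intro allI impI)
  fix U V assume U: "{x, y} = U \<union> V" and D: "U \<inter> V = {}" and ne: "U \<noteq> {}" "V \<noteq> {}"
  from ne obtain u v where uv: "u \<in> U" "v \<in> V" by auto
  from uv(1) have "u \<in> {x, y}" unfolding U by simp
  moreover from uv(2) have "v \<in> {x, y}" unfolding U by simp
  moreover from uv D have "u \<noteq> v" by auto
  ultimately have "\<kappa> u v" using assms by auto
  with uv show "\<exists>u\<in>U. \<exists>v\<in>V. \<kappa> u v" by (intro bexI)
qed

lemma digitally_continuous_iff_adjacent:
  assumes sym: "\<And>x y. \<kappa>1 x y \<Longrightarrow> \<kappa>1 y x"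
  shows "digitally_continuous \<kappa>1 \<kappa>2 X Y f \<longleftrightarrow>
    f ` X \<subseteq> Y \<and> (\<forall>x\<in>X. \<forall>y\<in>X. \<kappa>1 x y \<longrightarrow> f x = f y \<or> \<kappa>2 (f x) (f y))"
  unfolding digitally_continuous_def
proof (intro conj_cong refl iffI ballI allI impI)
  fix x y
  assume conn: "\<forall>S\<subseteq>X. digitally_connected \<kappa>1 S \<longrightarrow> digitally_connected \<kappa>2 (f ` S)"
    and xy: "x \<in> X" "y \<in> X" "\<kappa>1 x y"
  have "digitally_connected \<kappa>1 {x, y}"
    using xy(3) sym[OF xy(3)] by (rule digitally_connected_pair)
  with conn[rule_format, of "{x, y}"] xy have "digitally_connected \<kappa>2 {f x, f y}" by simp
  from this[unfolded digitally_connected_iff, rule_format, of "{f x}" "{f y}"]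
  show "f x = f y \<or> \<kappa>2 (f x) (f y)" by (cases "f x = f y") (auto simp: insert_commute)
next
  fix S
  assume adj: "\<forall>x\<in>X. \<forall>y\<in>X. \<kappa>1 x y \<longrightarrow> f x = f y \<or> \<kappa>2 (f x) (f y)"
    and S: "S \<subseteq> X" "digitally_connected \<kappa>1 S"
  show "digitally_connected \<kappa>2 (f ` S)"
    unfolding digitally_connected_iff
  proof (intro allI impI)
    fix U V assume U: "f ` S = U \<union> V" and D: "U \<inter> V = {}" and ne: "U \<noteq> {}" "V \<noteq> {}"
    let ?U = "{x \<in> S. f x \<in> U}" and ?V = "{x \<in> S. f x \<in> V}"
    have "f x \<in> U \<union> V" if "x \<in> S" for x using that unfolding U[symmetric] by simp
    then have 1: "S = ?U \<union> ?V" by auto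
    have 2: "?U \<inter> ?V = {}" using D by auto
    from ne obtain a b where ab: "a \<in> U" "b \<in> V" by auto
    then have "a \<in> f ` S" "b \<in> f ` S" unfolding U by simp_all
    with ab have 3: "?U \<noteq> {}" "?V \<noteq> {}" by auto
    obtain u v where uv: "u \<in> ?U" "v \<in> ?V" "\<kappa>1 u v"
      using S(2)[unfolded digitally_connected_iff, rule_format, OF 1 2 3] by auto
    moreover from uv D have "f u \<noteq> f v" by auto
    ultimately have "\<kappa>2 (f u) (f v)" using adj S(1) by auto
    with uv show "\<exists>u\<in>U. \<exists>v\<in>V. \<kappa>2 u v" by auto
  qed
qed

end

theory Submission
  imports Defs
begin

text \<open>
  Continuity only asks that adjacent points have equal or adjacent images, so a map that takes
  only two values, adjacent to each other, is continuous however irregularly these values are distributed. Comparing such a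
  map with a constant one shows that in an image with an adjacent pair \<^emph>\<open>every\<close> subset is a
  coincidence set (\<open>subset_is_coincidence_set\<close>); a connected image with at least two points has
  such a pair (\<open>connected_imp_adjacent_pair\<close>).

  Now let \<open>A\<close> be a retract of the connected image \<open>X\<close>. If \<open>A = X\<close> there is nothing to show.
  Otherwise \<open>A\<close> is non-empty, because a retraction has to send the points of \<open>X - A\<close> somewhere, so
  \<open>X\<close> has a point inside \<open>A\<close> and one outside. A coincidence set of two self-maps of \<open>A\<close> is in
  particular a subset of \<open>X\<close>, hence is itself a coincidence set of two self-maps of \<open>X\<close>. The new
  maps are unrelated to the old ones: extending the latter through the retraction \<open>r\<close> would replace
  the coincidence set \<open>C\<close> by its preimage under \<open>r\<close>, which may be larger.
\<close>

lemma connected_imp_adjacent_pair: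
  assumes conn: "digitally_connected \<kappa> X"
    and "p \<in> X" and "q \<in> X" and "p \<noteq> q"
  obtains y where "y \<in> X" and "\<kappa> p y"
proof -
  have "X = {p} \<union> (X - {p})" "{p} \<inter> (X - {p}) = {}" "{p} \<noteq> {}" "X - {p} \<noteq> {}"
    using assms(2-4) by auto
  then have "\<exists>u\<in>{p}. \<exists>v\<in>X - {p}. \<kappa> u v"
    using conn[unfolded digitally_connected_iff, rule_format, of "{p}" "X - {p}"] by blast
  then show thesis
    using that by blast
qed

lemma two_valued_continuous:
  assumes sym: "\<And>x y. \<kappa> x y \<Longrightarrow> \<kappa> y x"
    and "p \<in> X" and "q \<in> X" and "\<kappa> p q" and "f ` X \<subseteq> {p, q}"
  shows "digitally_continuous \<kappa> \<kappa> X X f"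
proof -
  have "f x = f y \<or> \<kappa> (f x) (f y)" if "x \<in> X" "y \<in> X" for x y
  proof -
    have "f x \<in> {p, q}" "f y \<in> {p, q}"
      using assms(5) that by blast+
    then show ?thesis
      using \<open>\<kappa> p q\<close> sym by auto
  qed
  moreover have "f ` X \<subseteq> X"
    using assms(2,3,5) by blast
  ultimately show ?thesis
    by (simp add: digitally_continuous_iff_adjacent[OF sym])
qed

text \<open>The constant map \<open>p\<close> meets the map that is \<open>p\<close> on \<open>C\<close> and \<open>q\<close> elsewhere exactly on \<open>C\<close>;
  irreflexivity of the adjacency keeps the two values apart.\<close>

lemma subset_is_coincidence_set:
  assumes sym: "\<And>x y. \<kappa> x y \<Longrightarrow> \<kappa> y x" and irrefl: "\<And>x. \<not> \<kappa> x x"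
    and pq: "p \<in> X" "q \<in> X" "\<kappa> p q" and "C \<subseteq> X"
  obtains f1 f2 where "digitally_continuous \<kappa> \<kappa> X X f1" and "digitally_continuous \<kappa> \<kappa> X X f2"
    and "coincidence_set X f1 f2 = C"
proof
  show "digitally_continuous \<kappa> \<kappa> X X (\<lambda>_. p)"
    by (rule two_valued_continuous[where \<kappa> = \<kappa>, OF _ pq]) (auto intro: sym)
  show "digitally_continuous \<kappa> \<kappa> X X (\<lambda>x. if x \<in> C then p else q)"
    by (rule two_valued_continuous[where \<kappa> = \<kappa>, OF _ pq]) (auto intro: sym)
  have "p \<noteq> q"
    using pq(3) irrefl by auto
  then show "coincidence_set X (\<lambda>_. p) (\<lambda>x. if x \<in> C then p else q) = C"
    using \<open>C \<subseteq> X\<close> by (auto simp: coincidence_set_def)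
qed

theorem theorem5p3:
  fixes X A :: "(int ^ 'n) set" and t :: nat
  assumes "1 \<le> t" and "t \<le> CARD('n)"
    and "digitally_connected (kappa t) X"
    and "digital_retract (kappa t) A X"
  shows "coincidence_spectrum (kappa t) A \<subseteq> coincidence_spectrum (kappa t) X"
proof (cases "A = X")
  case True
  then show ?thesis by simp
next
  case False
  from assms(4) obtain r where "A \<subseteq> X" and r: "r ` X \<subseteq> A"
    by (auto simp: digital_retract_def digitally_continuous_def)
  with False obtain x where x: "x \<in> X" "x \<notin> A"
    by blast
  with r have "r x \<in> A"
    by blast
  with x \<open>A \<subseteq> X\<close> have "r x \<in> X" "x \<noteq> r x"
    by auto
  with connected_imp_adjacent_pair[OF assms(3) x(1)]
  obtain y where y: "y \<in> X" "kappa t x y"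
    by blast
  show ?thesis
  proof
    fix k
    assume "k \<in> coincidence_spectrum (kappa t) A"
    then obtain g1 g2 :: "int ^ 'n \<Rightarrow> int ^ 'n"
      where k: "k = cardinality (coincidence_set A g1 g2)"
      unfolding coincidence_spectrum_def by blast
    have "coincidence_set A g1 g2 \<subseteq> X"
      using \<open>A \<subseteq> X\<close> by (auto simp: coincidence_set_def)
    moreover have "\<not> kappa t z z" for z :: "int ^ 'n"
      by (simp add: kappa_def)
    ultimately obtain f1 f2 where
      "digitally_continuous (kappa t) (kappa t) X X f1"
      "digitally_continuous (kappa t) (kappa t) X X f2"
      "coincidence_set X f1 f2 = coincidence_set A g1 g2"
      using subset_is_coincidence_set[where \<kappa> = "kappa t", OF kappa_sym _ x(1) y] by metis
    then show "k \<in> coincidence_spectrum (kappa t) X"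
      unfolding k coincidence_spectrum_def mem_Collect_eq by metis
  qed
qed

end
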